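(* Let $a,b\in\mathbf{Q}^\times$. Then $(a,b)_v=1$ for almost every (i.e. all but finitely many) place $v$ of $\mathbf{Q}$, and we have the product formula $$\prod_v (a,b)_v=1,$$ where $v$ runs over all places of $\mathbf{Q}$, namely the prime numbers and the archimedean place $\infty$.
   Context: The symbols $(a,b)_v\in\{1,-1\}$ for $a,b\in\mathbf{Q}^\times$ are defined by the following explicit formulas. For a prime $p$, let $\mathbf{Z}_{(p)}\subset\mathbf{Q}$ be the localization of $\mathbf{Z}$ at $p$. Every $x\in\mathbf{Q}^\times$ is uniquely $x=p^{v_p(x)}u_x$ with $v_p(x)\in\mathbf{Z}$ and $u_x\in\mathbf{Z}_{(p)}^\times$. Put $$t_{a,b}=(-1)^{v_p(a)v_p(b)}u_a^{v_p(b)}u_b^{-v_p(a)}\in\mathbf{Z}_{(p)}^\times.$$ - If $p$ is odd, $(a,b)_p=\lambda_p(t_{a,b})$, where for $u\in\mathbf{Z}_{(p)}^\times$, $\lambda_p(u)=1$ if the image of $u$ in $\mathbf{F}_p^\times$ is a square and $\lambda_p(u)=-1$ otherwise. - If $p=2$, $(a,b)_2=(-1)^{\varepsilon_4(u_a)\varepsilon_4(u_b)+\varepsilon_8(t_{a,b})}$, where for $u\in\mathbf{Z}_{(2)}^\times$, $\varepsilon_4(u)\in\mathbf{F}_2$ is $0$ if $u\equiv 1\pmod 4$ and $1$ if $u\equiv -1\pmod 4$, and $\varepsilon_8(u)\in\mathbf{F}_2$ is $0$ if $u\equiv\pm1\pmod 8$ and $1$ if $u\equiv\pm5\pmod 8$.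 - For $v=\infty$, $(a,b)_\infty=1$ if $a>0$ or $b>0$, and $(a,b)_\infty=-1$ if $a<0$ and $b<0$. *)

theory Defs
  imports "HOL-Number_Theory.Number_Theory"
begin

text \<open>The localization \<open>\<int>\<^bsub>(p)\<^esub>\<close> as a subring of the rationals, and its group of units.
  The condition \<open>\<not> int p dvd n\<close> includes \<open>n \<noteq> 0\<close>.\<close>

definition loc_int :: "nat \<Rightarrow> rat set" where
  "loc_int p = {of_int m / of_int n | m n :: int. \<not> int p dvd n}"

definition loc_units :: "nat \<Rightarrow> rat set" where
  "loc_units p = {u \<in> loc_int p. \<exists>w \<in> loc_int p. u * w = 1}"

definition loc_cong :: "nat \<Rightarrow> int \<Rightarrow> rat \<Rightarrow> rat \<Rightarrow> bool" where
  "loc_cong p m x y \<longleftrightarrow> (\<exists>z \<in> loc_int p. x - y = of_int m * z)"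

definition val :: "nat \<Rightarrow> rat \<Rightarrow> int" where
  "val p x = (THE k. \<exists>u \<in> loc_units p. x = of_nat p powi k * u)"

definition unit_part :: "nat \<Rightarrow> rat \<Rightarrow> rat" where
  "unit_part p x = (THE u. u \<in> loc_units p \<and> x = of_nat p powi val p x * u)"

definition tame :: "nat \<Rightarrow> rat \<Rightarrow> rat \<Rightarrow> rat" where
  "tame p a b = (- 1) powi (val p a * val p b)
     * unit_part p a powi val p b * unit_part p b powi (- val p a)"

text \<open>The image in \<open>\<int>\<^bsub>(p)\<^esub>/p = F\<^sub>p\<close>, given by its representative in \<open>{0..<p}\<close>.\<close>

definition residue_mod :: "nat \<Rightarrow> rat \<Rightarrow> int" where
  "residue_mod p u = (THE r. r \<in> {0..<int p} \<and> loc_cong p (int p) u (of_int r))"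

definition lambda :: "nat \<Rightarrow> rat \<Rightarrow> int" where
  "lambda p u = (if QuadRes (int p) (residue_mod p u) then 1 else - 1)"

text \<open>The values of \<open>\<epsilon>\<^sub>4\<close> and \<open>\<epsilon>\<^sub>8\<close> in the field with two elements are represented by
  the natural numbers 0 and 1; they are only used as exponents of \<open>-1\<close>. On \<open>loc_units 2\<close> the
  \<open>else\<close> branches are the cases \<open>u \<equiv> -1 (mod 4)\<close> and \<open>u \<equiv> \<plusminus>5 (mod 8)\<close>.\<close>

definition eps4 :: "rat \<Rightarrow> nat" where
  "eps4 u = (if loc_cong 2 4 u 1 then 0 else 1)"

definition eps8 :: "rat \<Rightarrow> nat" where
  "eps8 u = (if loc_cong 2 8 u 1 \<or> loc_cong 2 8 u (- 1) then 0 else 1)"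

datatype place = Finite_Place nat | Infinite_Place

definition places :: "place set" where
  "places = insert Infinite_Place (Finite_Place ` {p. prime p})"

fun hilbert_symbol :: "rat \<Rightarrow> rat \<Rightarrow> place \<Rightarrow> int" where
  "hilbert_symbol a b (Finite_Place p) =
     (if p = 2
      then (- 1) ^ (eps4 (unit_part 2 a) * eps4 (unit_part 2 b) + eps8 (tame 2 a b))
      else lambda p (tame p a b))"
| "hilbert_symbol a b Infinite_Place = (if a > 0 \<or> b > 0 then 1 else - 1)"

text \<open>The definite descriptions in \<open>val\<close>, \<open>unit_part\<close> and \<open>residue_mod\<close> are well defined.\<close>

lemma loc_units_iff:
  assumes "prime p"
  shows "u \<in> loc_units p \<longleftrightarrow>
    (\<exists>m n :: int. u = of_int m / of_int n \<and> \<not> int p dvd m \<and> \<not> int p dvd n)"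
proof
  assume "u \<in> loc_units p"
  then obtain m n m' n' :: int where 1: "u = of_int m / of_int n" "\<not> int p dvd n"
    "\<not> int p dvd n'" "u * (of_int m' / of_int n') = 1"
    unfolding loc_units_def loc_int_def by blast
  have "n \<noteq> 0" "n' \<noteq> 0" using 1 by auto
  with 1 have "of_int (m * m') = (of_int (n * n') :: rat)" by (simp add: field_simps)
  hence "m * m' = n * n'" by (simp only: of_int_eq_iff)
  moreover have "\<not> int p dvd n * n'" using 1 assms by (simp add: prime_dvd_mult_iff)
  ultimately have "\<not> int p dvd m" by (metis dvd_mult2)
  with 1 show "\<exists>m n :: int. u = of_int m / of_int n \<and> \<not> int p dvd m \<and> \<not> int p dvd n"
    by blast
next
  assume "\<exists>m n :: int. u = of_int m / of_int n \<and> \<not> int p dvd m \<and> \<not> int p dvd n"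
  then obtain m n :: int where 1: "u = of_int m / of_int n" "\<not> int p dvd m" "\<not> int p dvd n"
    by blast
  have "m \<noteq> 0" "n \<noteq> 0" using 1 by auto
  hence "u * (of_int n / of_int m) = 1" using 1 by simp
  thus "u \<in> loc_units p" unfolding loc_units_def loc_int_def using 1 by blast
qed

lemma val_unit_part_exists:
  assumes p: "prime p" and x: "x \<noteq> 0"
  shows "\<exists>k. \<exists>u \<in> loc_units p. x = of_nat p powi k * u"
proof -
  have p0: "(of_nat p :: rat) \<noteq> 0" using p by auto
  obtain a b :: int where ab: "x = of_int a / of_int b" "b > 0"
    by (metis Fract_of_int_quotient quotient_of_denom_pos quotient_of_div surj_pair)
  have a: "a \<noteq> 0" using ab x by auto
  have nu: "\<not> is_unit (int p)" using p by auto
  obtain m where m: "a = int p ^ multiplicity (int p) a * m" "\<not> int p dvd m"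
    using multiplicity_decompose'[OF a nu] by blast
  have b: "b \<noteq> 0" using ab by auto
  obtain n where n: "b = int p ^ multiplicity (int p) b * n" "\<not> int p dvd n"
    using multiplicity_decompose'[OF b nu] by blast
  let ?i = "multiplicity (int p) a" and ?j = "multiplicity (int p) b"
  have A: "(of_int a :: rat) = of_nat p ^ ?i * of_int m" 
    by (subst m(1)) simp
  have B: "(of_int b :: rat) = of_nat p ^ ?j * of_int n"
    by (subst n(1)) simp
  have "x = of_nat p powi (int ?i - int ?j) * (of_int m / of_int n)"
    unfolding ab(1) A B using p0 by (simp add: power_int_diff)
  moreover have "of_int m / of_int n \<in> loc_units p"
    using m(2) n(2) loc_units_iff[OF p] by blast
  ultimately show ?thesis by blast
qed

lemma loc_units_mult_powi_unique:
  assumes p: "prime p" and u: "u \<in> loc_units p" and w: "w \<in> loc_units p"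
    and eq: "of_nat p powi k * u = of_nat p powi l * w"
  shows "k = l \<and> u = w"
proof -
  have p0: "(of_nat p :: rat) \<noteq> 0" using p by auto
  have le: "\<not> k < l" if u: "u \<in> loc_units p" and w: "w \<in> loc_units p"
    and eq: "of_nat p powi k * u = of_nat p powi l * w" for u w :: rat and k l :: int
  proof
    assume "k < l"
    define d where "d = nat (l - k)"
    have d: "l = k + int d" "d > 0" using \<open>k < l\<close> by (auto simp: d_def)
    have "of_nat p powi k * u = of_nat p powi k * (of_nat p ^ d * w)"
      using eq p0 by (simp add: d power_int_add)
    hence uw: "u = of_nat p ^ d * w" using p0 by simp
    obtain m n where mn: "u = of_int m / of_int n" "\<not> int p dvd m" "\<not> int p dvd n"
      using u loc_units_iff[OF p] by blast
    obtain m' n' where mn': "w = of_int m' / of_int n'" "\<not> int p dvd m'" "\<not> int p dvd n'"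
      using w loc_units_iff[OF p] by blast
    have nz: "n \<noteq> 0" "n' \<noteq> 0" using mn mn' by auto
    have "(of_int (m * n') :: rat) = of_int (int p ^ d * m' * n)"
      using uw nz unfolding mn(1) mn'(1) by (simp add: field_simps)
    hence "m * n' = int p ^ d * m' * n" by (simp only: of_int_eq_iff)
    moreover have "int p dvd int p ^ d" using d by (simp add: dvd_power)
    ultimately have "int p dvd m * n'" by (simp add: dvd_mult2)
    thus False using mn mn' p by (simp add: prime_dvd_mult_iff)
  qed
  have "k = l" using le[OF u w eq] le[OF w u eq[symmetric]] by simp
  thus ?thesis using eq p0 by simp
qed

lemma unit_part_in_loc_units_and_decomposition:
  assumes p: "prime p" and x: "x \<noteq> 0"
  shows "unit_part p x \<in> loc_units p \<and> x = of_nat p powi val p x * unit_part p x"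
proof -
  obtain k u where ku: "u \<in> loc_units p" "x = of_nat p powi k * u"
    using val_unit_part_exists[OF assms] by blast
  have v: "val p x = k" unfolding val_def
    using ku loc_units_mult_powi_unique[OF p] by (intro the_equality) blast+
  show ?thesis unfolding unit_part_def v
    by (rule theI[where a = u]) (use ku loc_units_mult_powi_unique[OF p] in blast)+
qed

lemma residue_mod_exists_unique:
  assumes p: "prime p" and u: "u \<in> loc_int p"
  shows "\<exists>!r. r \<in> {0..<int p} \<and> loc_cong p (int p) u (of_int r)"
proof -
  obtain m n :: int where u': "u = of_int m / of_int n" "\<not> int p dvd n"
    using u unfolding loc_int_def by blast
  have n: "n \<noteq> 0" using u' by auto
  have p0: "p > 0" using p by (simp add: prime_gt_0_nat)
  have cop: "coprime n (int p)"
    using u' p by (metis coprime_commute prime_imp_coprime prime_nat_int_transfer)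
  have *: "loc_cong p (int p) u (of_int r) \<longleftrightarrow> int p dvd m - r * n" for r
  proof
    assume "loc_cong p (int p) u (of_int r)"
    then obtain s t where st: "\<not> int p dvd t" "u - of_int r = of_int (int p) * (of_int s / of_int t)"
      unfolding loc_cong_def loc_int_def by blast
    have t: "t \<noteq> 0" using st by auto
    have "(of_int ((m - r * n) * t) :: rat) = of_int (int p * s * n)"
      using st(2) n t unfolding u'(1) by (simp add: field_simps)
    hence "(m - r * n) * t = int p * s * n" by (simp only: of_int_eq_iff)
    hence "int p dvd (m - r * n) * t" by simp
    thus "int p dvd m - r * n" using st(1) p by (simp add: prime_dvd_mult_iff)
  next
    assume "int p dvd m - r * n"
    then obtain s where s: "m - r * n = int p * s" by blast
    have "u - of_int r = of_int (m - r * n) / of_int n" using n u' by (simp add: field_simps)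
    hence "u - of_int r = of_int (int p) * (of_int s / of_int n)" by (simp add: s)
    thus "loc_cong p (int p) u (of_int r)" unfolding loc_cong_def loc_int_def
      using u'(2) by blast
  qed
  obtain y where y: "[n * y = 1] (mod int p)" using cop cong_solve_coprime_int by blast
  define r where "r = (m * y) mod int p"
  have "[r * n = m * (n * y)] (mod int p)"
    unfolding r_def by (simp add: cong_def mod_simps mult_ac)
  also have "[m * (n * y) = m * 1] (mod int p)" by (rule cong_mult[OF cong_refl y])
  finally have "int p dvd m - r * n" by (metis cong_iff_dvd_diff cong_sym mult.right_neutral)
  moreover have "r \<in> {0..<int p}" using p0 by (simp add: r_def)
  ultimately show ?thesis
  proof (intro ex1I[of _ r], goal_cases)
    case (2 q)
    have "int p dvd m - r * n" "int p dvd m - q * n" using 2 * by blast+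
    hence "int p dvd (m - r * n) - (m - q * n)" by (rule dvd_diff)
    also have "(m - r * n) - (m - q * n) = (q - r) * n" by (simp add: algebra_simps)
    finally have "int p dvd q - r" using u'(2) p by (simp add: prime_dvd_mult_iff)
    hence "[q = r] (mod int p)" by (simp add: cong_iff_dvd_diff)
    thus ?case using 2 by (simp add: cong_def)
  qed (simp add: *)
qed

end

theory Submission
  imports Defs
begin

text \<open>At every place the symbol is symmetric and multiplicative in each argument, so the set of
  pairs satisfying the product formula is closed under multiplication in each argument. A fraction
  \<open>m / n\<close> has the same symbols as the integer \<open>m n\<close>, since they differ by a square; hence it
  suffices to treat \<open>-1\<close> and the primes. For two distinct odd primes the formula is quadratic
  reciprocity, for the pairs \<open>(-1, p)\<close>, \<open>(p, p)\<close> and \<open>(2, p)\<close> with \<open>p\<close> odd it is one of the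
  supplementary laws, and the pairs formed from \<open>-1\<close> and \<open>2\<close> are a direct computation. The
  second supplementary law comes from Gauss's lemma, by counting the doubles in the upper half
  of the residues.\<close>

section \<open>The local ring at a prime\<close>

context
  fixes p :: nat
  assumes p: "prime p"
begin

section \<open>Closure properties of the local ring and its unit group\<close>

lemma of_int_in_loc_int: "of_int m \<in> loc_int p"
  unfolding loc_int_def using p
  by (intro CollectI exI[of _ m] exI[of _ 1]) auto

lemma loc_int_add: "x \<in> loc_int p \<Longrightarrow> y \<in> loc_int p \<Longrightarrow> x + y \<in> loc_int p"
proof -
  assume "x \<in> loc_int p" "y \<in> loc_int p"
  then obtain m n m' n' :: int where 1: "x = of_int m / of_int n" "\<not> int p dvd n"
    "y = of_int m' / of_int n'" "\<not> int p dvd n'"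
    unfolding loc_int_def by blast
  have "n \<noteq> 0" "n' \<noteq> 0" using 1 by auto
  hence "x + y = of_int (m * n' + m' * n) / of_int (n * n')" using 1 by (simp add: field_simps)
  moreover have "\<not> int p dvd n * n'" using 1 p by (simp add: prime_dvd_mult_iff)
  ultimately show ?thesis unfolding loc_int_def by blast
qed

lemma loc_int_mult: "x \<in> loc_int p \<Longrightarrow> y \<in> loc_int p \<Longrightarrow> x * y \<in> loc_int p"
proof -
  assume "x \<in> loc_int p" "y \<in> loc_int p"
  then obtain m n m' n' :: int where 1: "x = of_int m / of_int n" "\<not> int p dvd n"
    "y = of_int m' / of_int n'" "\<not> int p dvd n'"
    unfolding loc_int_def by blast
  have "x * y = of_int (m * m') / of_int (n * n')" using 1 by simp
  moreover have "\<not> int p dvd n * n'" using 1 p by (simp add: prime_dvd_mult_iff)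
  ultimately show ?thesis unfolding loc_int_def by blast
qed

lemma loc_int_uminus: "x \<in> loc_int p \<Longrightarrow> - x \<in> loc_int p"
  using loc_int_mult[OF of_int_in_loc_int[of "- 1"], of x] by simp

lemma loc_units_subset: "u \<in> loc_units p \<Longrightarrow> u \<in> loc_int p"
  by (simp add: loc_units_def)

lemma loc_units_nonzero: "u \<in> loc_units p \<Longrightarrow> u \<noteq> 0"
  by (auto simp: loc_units_def)

lemma of_int_in_loc_units: "\<not> int p dvd m \<Longrightarrow> of_int m \<in> loc_units p"
  unfolding loc_units_iff[OF p] using p
  by (intro exI[of _ m] exI[of _ 1]) auto

lemma one_in_loc_units: "1 \<in> loc_units p"
  and minus_one_in_loc_units: "- 1 \<in> loc_units p"
  using of_int_in_loc_units[of 1] of_int_in_loc_units[of "- 1"] prime_gt_1_nat[OF p] by auto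

lemma loc_units_mult:
  assumes "u \<in> loc_units p" "w \<in> loc_units p"
  shows "u * w \<in> loc_units p"
proof -
  obtain u' w' where "u' \<in> loc_int p" "u * u' = 1" "w' \<in> loc_int p" "w * w' = 1"
    using assms unfolding loc_units_def by blast
  moreover from this have "(u * w) * (u' * w') = 1" by (simp add: mult_ac)
  ultimately show ?thesis
    using assms loc_int_mult unfolding loc_units_def by blast
qed

lemma loc_units_inverse: "u \<in> loc_units p \<Longrightarrow> inverse u \<in> loc_units p"
proof -
  assume "u \<in> loc_units p"
  then obtain w where w: "u \<in> loc_int p" "w \<in> loc_int p" "u * w = 1"
    unfolding loc_units_def by blast
  hence "inverse u = w" by (simp add: inverse_unique)
  moreover have "w * u = 1" using w by (simp add: mult.commute)
  ultimately show ?thesis using w unfolding loc_units_def by blast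
qed

lemma loc_units_powi: "u \<in> loc_units p \<Longrightarrow> u powi k \<in> loc_units p"
proof -
  assume u: "u \<in> loc_units p"
  have *: "w ^ n \<in> loc_units p" if "w \<in> loc_units p" for w and n :: nat
    by (induction n) (use that in \<open>auto intro: one_in_loc_units loc_units_mult\<close>)
  show ?thesis
    using *[OF u] *[OF loc_units_inverse[OF u]] by (simp add: power_int_def)
qed

section \<open>Congruences in the local ring and their integer representatives\<close>

lemma loc_cong_refl: "loc_cong p m x x"
  unfolding loc_cong_def using of_int_in_loc_int[of 0] by (intro bexI[of _ 0]) auto

lemma loc_cong_sym: "loc_cong p m x y \<Longrightarrow> loc_cong p m y x"
proof -
  assume "loc_cong p m x y"
  then obtain z where "z \<in> loc_int p" "x - y = of_int m * z" unfolding loc_cong_def by blast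
  thus ?thesis unfolding loc_cong_def
    by (intro bexI[of _ "- z"]) (auto simp: loc_int_uminus algebra_simps)
qed

lemma loc_cong_trans:
  assumes "loc_cong p m x y" "loc_cong p m y z"
  shows "loc_cong p m x z"
proof -
  obtain s t where "s \<in> loc_int p" "x - y = of_int m * s" "t \<in> loc_int p" "y - z = of_int m * t"
    using assms unfolding loc_cong_def by blast
  thus ?thesis unfolding loc_cong_def
    by (intro bexI[of _ "s + t"]) (auto simp: loc_int_add algebra_simps)
qed

text \<open>The difference of the products is \<open>x * (x' - y') + (x - y) * y'\<close>; this is
  why integrality is asked of exactly \<open>x\<close> and \<open>y'\<close>.\<close>

lemma loc_cong_mult:
  assumes "loc_cong p m x y" "loc_cong p m x' y'" "x \<in> loc_int p" "y' \<in> loc_int p"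
  shows "loc_cong p m (x * x') (y * y')"
proof -
  obtain s t where st: "s \<in> loc_int p" "x - y = of_int m * s"
      "t \<in> loc_int p" "x' - y' = of_int m * t"
    using assms unfolding loc_cong_def by blast
  have "x * x' - y * y' = x * (x' - y') + (x - y) * y'" by (simp add: algebra_simps)
  also have "\<dots> = of_int m * (x * t + s * y')" unfolding st by (simp add: algebra_simps)
  finally show ?thesis unfolding loc_cong_def
    using st assms by (meson loc_int_add loc_int_mult)
qed

text \<open>Denominators prime to \<open>p\<close> cancel modulo \<open>p ^ k\<close>, so the map
  from integers modulo \<open>p ^ k\<close> to the local ring modulo \<open>p ^ k\<close> is
  injective.\<close>

lemma loc_cong_of_int_iff:
  "loc_cong p (int p ^ k) (of_int r) (of_int s) \<longleftrightarrow> [r = s] (mod int p ^ k)"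
proof
  assume "loc_cong p (int p ^ k) (of_int r) (of_int s)"
  then obtain m n :: int where mn: "\<not> int p dvd n"
      "of_int r - of_int s = (of_int (int p ^ k) * (of_int m / of_int n) :: rat)"
    unfolding loc_cong_def loc_int_def by blast
  have "n \<noteq> 0" using mn by auto
  with mn have "(of_int ((r - s) * n) :: rat) = of_int (int p ^ k * m)"
    by (simp add: field_simps)
  hence "(r - s) * n = int p ^ k * m" by (simp only: of_int_eq_iff)
  hence "int p ^ k dvd (r - s) * n" by simp
  moreover have "coprime (int p ^ k) n"
    using mn p by (simp add: prime_imp_coprime)
  ultimately show "[r = s] (mod int p ^ k)"
    by (simp add: coprime_dvd_mult_left_iff cong_iff_dvd_diff)
next
  assume "[r = s] (mod int p ^ k)"
  then obtain z where "r - s = int p ^ k * z" by (auto simp: cong_iff_dvd_diff)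
  hence "(of_int r - of_int s :: rat) = of_int (int p ^ k) * of_int z"
    by (metis of_int_diff of_int_mult)
  thus "loc_cong p (int p ^ k) (of_int r) (of_int s)"
    unfolding loc_cong_def using of_int_in_loc_int by blast
qed

text \<open>Surjectivity of the same map: the denominator is inverted modulo \<open>p ^ k\<close>.
  Residue symbols can therefore be computed on integers.\<close>

lemma loc_int_cong_of_int:
  assumes "u \<in> loc_int p"
  obtains r where "loc_cong p (int p ^ k) u (of_int r)"
proof -
  obtain m n :: int where u: "u = of_int m / of_int n" "\<not> int p dvd n"
    using assms unfolding loc_int_def by blast
  have n: "n \<noteq> 0" using u by auto
  have "coprime n (int p ^ k)" using u p
    by (metis coprime_commute coprime_power_left_iff prime_imp_coprime prime_nat_int_transfer)
  then obtain y where "[n * y = 1] (mod int p ^ k)" using cong_solve_coprime_int by blast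
  then obtain z where z: "n * y - 1 = int p ^ k * z" by (auto simp: cong_iff_dvd_diff)
  have "u - of_int (m * y) = - (of_int m * of_int (n * y - 1) / of_int n)"
    using n unfolding u(1) by (simp add: field_simps)
  also have "\<dots> = of_int (int p ^ k) * (of_int (- m * z) / of_int n)"
    unfolding z by simp
  finally have "loc_cong p (int p ^ k) u (of_int (m * y))"
    unfolding loc_cong_def loc_int_def using u(2) by blast
  thus ?thesis by (rule that)
qed

text \<open>The inverse of \<open>u\<close> has an integer representative \<open>s\<close> as well,
  and \<open>r * s\<close> is then congruent to 1.\<close>

lemma loc_unit_cong_not_dvd:
  assumes u: "u \<in> loc_units p" and r: "loc_cong p (int p ^ k) u (of_int r)" and k: "k > 0"
  shows "\<not> int p dvd r"
proof
  assume "int p dvd r"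
  obtain w where w: "u \<in> loc_int p" "w \<in> loc_int p" "u * w = 1"
    using u unfolding loc_units_def by blast
  obtain s where s: "loc_cong p (int p ^ k) w (of_int s)"
    using loc_int_cong_of_int[OF w(2)] by blast
  have "loc_cong p (int p ^ k) (of_int 1) (of_int (r * s))"
    using loc_cong_mult[OF r s w(1) of_int_in_loc_int] w(3) by simp
  hence "[1 = r * s] (mod int p ^ k)" unfolding loc_cong_of_int_iff .
  hence "[1 = r * s] (mod int p)" using k by (meson cong_dvd_modulus dvd_power)
  hence "int p dvd 1" using \<open>int p dvd r\<close> by (metis cong_dvd_iff dvd_mult2)
  thus False using p by simp
qed

section \<open>Valuation, unit part and tame symbol\<close>

lemma val_unit_part_eqI:
  assumes u: "u \<in> loc_units p" and x: "x = of_nat p powi k * u"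
  shows "val p x = k" "unit_part p x = u"
proof -
  have "x \<noteq> 0" using x loc_units_nonzero[OF u] p by auto
  note d = unit_part_in_loc_units_and_decomposition[OF p this]
  \<comment> \<open>Uniqueness of the decomposition makes the definite descriptions computable: any
    exhibited decomposition gives their values.\<close>
  have "val p x = k \<and> unit_part p x = u"
    by (rule loc_units_mult_powi_unique[OF p]) (use d u x in auto)
  thus "val p x = k" "unit_part p x = u" by auto
qed

lemma unit_part_in_loc_units: "x \<noteq> 0 \<Longrightarrow> unit_part p x \<in> loc_units p"
  using unit_part_in_loc_units_and_decomposition[OF p] by blast

lemma val_unit_part_mult:
  assumes "x \<noteq> 0" "y \<noteq> 0"
  shows "val p (x * y) = val p x + val p y"
    and "unit_part p (x * y) = unit_part p x * unit_part p y"
proof -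
  note dx = unit_part_in_loc_units_and_decomposition[OF p assms(1)]
  note dy = unit_part_in_loc_units_and_decomposition[OF p assms(2)]
  have "(of_nat p :: rat) \<noteq> 0" using p by auto
  hence "of_nat p powi (val p x + val p y) * (unit_part p x * unit_part p y)
      = (of_nat p powi val p x * unit_part p x) * (of_nat p powi val p y * unit_part p y)"
    by (simp add: power_int_add)
  hence "x * y = of_nat p powi (val p x + val p y) * (unit_part p x * unit_part p y)"
    using dx dy by argo
  thus "val p (x * y) = val p x + val p y" "unit_part p (x * y) = unit_part p x * unit_part p y"
    using val_unit_part_eqI[OF loc_units_mult] dx dy by simp_all
qed

lemma val_unit_part_of_unit:
  assumes "u \<in> loc_units p"
  shows "val p u = 0" "unit_part p u = u"
  using val_unit_part_eqI[OF assms, of u 0] by simp_all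

lemma val_unit_part_self: "val p (of_nat p) = 1" "unit_part p (of_nat p) = 1"
  using val_unit_part_eqI[OF one_in_loc_units, of "of_nat p" 1] by simp_all

lemma tame_in_loc_units: "x \<noteq> 0 \<Longrightarrow> y \<noteq> 0 \<Longrightarrow> tame p x y \<in> loc_units p"
  unfolding tame_def
  by (intro loc_units_mult loc_units_powi minus_one_in_loc_units unit_part_in_loc_units)

lemma tame_mult:
  assumes "x \<noteq> 0" "y \<noteq> 0" "z \<noteq> 0"
  shows "tame p (x * y) z = tame p x z * tame p y z"
proof -
  note nz = assms[THEN unit_part_in_loc_units, THEN loc_units_nonzero]
  have "(- 1 :: rat) powi ((val p x + val p y) * val p z)
      = (- 1) powi (val p x * val p z) * (- 1) powi (val p y * val p z)"
    by (simp add: distrib_right power_int_add)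
  moreover have "unit_part p z powi (- (val p x + val p y))
      = unit_part p z powi (- val p x) * unit_part p z powi (- val p y)"
    using power_int_add[of "unit_part p z" "- val p x" "- val p y"] nz by simp
  ultimately show ?thesis
    unfolding tame_def val_unit_part_mult[OF assms(1,2)]
    by (simp add: power_int_mult_distrib mult_ac)
qed

text \<open>The sign is its own inverse, and exchanging the arguments negates both exponents of the
  unit parts.\<close>

lemma tame_swap: "tame p y x = inverse (tame p x y)"
proof -
  have "inverse ((- 1 :: rat) powi k) = (- 1) powi k" for k
    by (simp flip: power_int_inverse)
  thus ?thesis unfolding tame_def power_int_minus inverse_mult_distrib inverse_inverse_eq
    by (simp only: mult_ac)
qed

text \<open>Any integer representative may replace the canonical residue. The value 0 of the
  Legendre symbol cannot occur, since a unit has no representative divisible by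
  \<open>p\<close>.\<close>

lemma lambda_eq_Legendre:
  assumes u: "u \<in> loc_units p" and r: "loc_cong p (int p) u (of_int r)"
  shows "lambda p u = Legendre r (int p)"
proof -
  have "[r = r mod int p] (mod int p ^ 1)" by (simp add: cong_def)
  hence "loc_cong p (int p) (of_int r) (of_int (r mod int p))"
    using loc_cong_of_int_iff[of 1 r "r mod int p"] by simp
  hence "loc_cong p (int p) u (of_int (r mod int p))" using r loc_cong_trans by blast
  moreover have "r mod int p \<in> {0..<int p}" using prime_gt_0_nat[OF p] by simp
  ultimately have "residue_mod p u = r mod int p"
    unfolding residue_mod_def
    using the1_equality[OF residue_mod_exists_unique[OF p loc_units_subset[OF u]]] by blast
  moreover have "\<not> [r = 0] (mod int p)"
    using loc_unit_cong_not_dvd[OF u, of 1 r] r by (simp add: cong_0_iff)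
  ultimately show ?thesis
    by (simp add: lambda_def Legendre_def QuadRes_def cong_def)
qed

end

section \<open>Legendre symbols\<close>

text \<open>Two integers of absolute value at most 1 differ by at most 2, so a modulus above 2
  separates them. This turns Euler's criterion into equalities.\<close>

lemma sign_cong_imp_eq:
  fixes x y p :: int
  assumes "[x = y] (mod p)" "p > 2" "\<bar>x\<bar> \<le> 1" "\<bar>y\<bar> \<le> 1"
  shows "x = y"
proof (rule ccontr)
  assume "x \<noteq> y"
  moreover have "p dvd x - y" using assms(1) by (simp add: cong_iff_dvd_diff)
  ultimately have "\<bar>p\<bar> \<le> \<bar>x - y\<bar>" by (intro dvd_imp_le_int) auto
  thus False using assms by linarith
qed

lemma abs_Legendre_le_1: "\<bar>Legendre x p\<bar> \<le> 1"
  by (simp add: Legendre_def)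

text \<open>By Euler's criterion both sides are congruent to
  \<open>(x * y) ^ ((p - 1) div 2)\<close>.\<close>

lemma Legendre_mult:
  assumes p: "prime p" "2 < p"
  shows "Legendre (x * y) (int p) = Legendre x (int p) * Legendre y (int p)"
proof (rule sign_cong_imp_eq[where p = "int p"])
  let ?k = "(p - 1) div 2"
  have "[Legendre x (int p) * Legendre y (int p) = x ^ ?k * y ^ ?k] (mod int p)"
    by (intro cong_mult euler_criterion p)
  moreover have "[Legendre (x * y) (int p) = (x * y) ^ ?k] (mod int p)"
    by (intro euler_criterion p)
  ultimately show "[Legendre (x * y) (int p) = Legendre x (int p) * Legendre y (int p)] (mod int p)"
    unfolding power_mult_distrib by (rule cong_trans[OF _ cong_sym, rotated])
qed (use p in \<open>simp_all add: Legendre_def\<close>)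

lemma Legendre_minus_one:
  assumes p: "prime p" "2 < p"
  shows "Legendre (- 1) (int p) = (- 1) ^ ((p - 1) div 2)"
  by (rule sign_cong_imp_eq[OF euler_criterion[OF p]])
    (use p in \<open>auto simp: abs_Legendre_le_1 power_abs\<close>)

text \<open>Gauss's lemma with multiplier 2: the sign is the parity of the number of doubles
  \<open>2 * x\<close>, with \<open>x\<close> in \<open>{1..h}\<close>, that exceed
  \<open>h = (p - 1) / 2\<close>.\<close>

lemma Legendre_two:
  assumes p: "prime p" "2 < p"
  shows "Legendre 2 (int p) = (if int p mod 8 = 1 \<or> int p mod 8 = 7 then 1 else - 1)"
proof -
  have odd: "odd p" using p prime_odd_nat by auto
  have "\<not> [2 = 0] (mod int p)"
    using p by (auto simp: cong_0_iff dest!: zdvd_imp_le)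
  then interpret G: GAUSS p 2 using p by unfold_locales auto
  define h where "h = (int p - 1) div 2"
  have ph: "int p = 2 * h + 1" "h > 0" using odd p unfolding h_def by presburger+
  \<comment> \<open>The doubles are at most \<open>2 * h < p\<close>, so reduction modulo
    \<open>p\<close> leaves them unchanged.\<close>
  have "G.C = G.B"
  proof -
    have "x mod int p = x" if "x \<in> G.B" for x
      using that ph by (auto simp: G.B_def G.A_def intro!: mod_pos_pos_trivial)
    thus ?thesis unfolding G.C_def by simp
  qed
  \<comment> \<open>The double of \<open>x\<close> exceeds \<open>h\<close> exactly when
    \<open>x > h div 2\<close>.\<close>
  hence "G.E = (\<lambda>x. x * 2) ` {h div 2<..h}"
    unfolding G.E_def G.B_def G.A_def h_def[symmetric] by (auto simp: image_iff)
  hence "card G.E = card {h div 2<..h}"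
    by (simp add: card_image inj_on_def)
  hence card: "card G.E = nat (h - h div 2)" by simp
  have "even (card G.E) \<longleftrightarrow> int p mod 8 = 1 \<or> int p mod 8 = 7"
  proof -
    have "even (nat (h - h div 2)) \<longleftrightarrow> even (h - h div 2)"
      using ph by (simp add: even_nat_iff)
    also have "\<dots> \<longleftrightarrow> int p mod 8 = 1 \<or> int p mod 8 = 7"
    proof -
      \<comment> \<open>Since \<open>p = 2 * h + 1\<close>, the class of \<open>h\<close> modulo 4
        determines that of \<open>p\<close> modulo 8.\<close>
      define k where "k = h div 4"
      have "h mod 4 \<in> {0..<4}" by simp
      hence "h mod 4 = 0 \<or> h mod 4 = 1 \<or> h mod 4 = 2 \<or> h mod 4 = 3" by force
      moreover have "h = 4 * k + h mod 4" by (simp add: k_def)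
      ultimately consider "h = 4 * k" | "h = 4 * k + 1" | "h = 4 * k + 2" | "h = 4 * k + 3"
        by (metis add.right_neutral)
      thus ?thesis
      proof cases
        case 1
        hence "h div 2 = 2 * k" "int p = 8 * k + 1" using ph(1) by simp_all
        thus ?thesis using 1 by simp
      next
        case 2
        hence "h div 2 = 2 * k" "int p = 8 * k + 3" using ph(1) by simp_all
        thus ?thesis using 2 by simp
      next
        case 3
        hence "h div 2 = 2 * k + 1" "int p = 8 * k + 5" using ph(1) by simp_all
        thus ?thesis using 3 by simp
      next
        case 4
        hence "h div 2 = 2 * k + 1" "int p = 8 * k + 7" using ph(1) by simp_all
        thus ?thesis using 4 by simp
      qed
    qed
    finally show ?thesis unfolding card .
  qed
  thus ?thesis using G.gauss_lemma by simp
qed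

section \<open>The functions eps4 and eps8\<close>

text \<open>The congruence is taken modulo 8 rather than 4, so that one representative serves both
  \<open>eps4\<close> and \<open>eps8\<close>.\<close>

lemma eps4_cong:
  assumes "loc_cong 2 8 u (of_int r)"
  shows "eps4 u = (if r mod 4 = 1 then 0 else 1)"
proof -
  have t: "prime (2::nat)" by simp
  obtain z where z: "z \<in> loc_int 2" "u - of_int r = of_int 8 * z"
    using assms unfolding loc_cong_def by blast
  have "of_int 2 * z \<in> loc_int 2" using z loc_int_mult[OF t of_int_in_loc_int[OF t]] by blast
  moreover have "u - of_int r = of_int 4 * (of_int 2 * z)" using z by simp
  ultimately have "loc_cong 2 4 u (of_int r)" unfolding loc_cong_def by blast
  hence "loc_cong 2 4 u (of_int 1) \<longleftrightarrow> loc_cong 2 4 (of_int r) (of_int 1)"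
    using loc_cong_trans[OF t] loc_cong_sym[OF t] by blast
  also have "\<dots> \<longleftrightarrow> r mod 4 = 1"
    using loc_cong_of_int_iff[OF t, of 2 r 1] by (simp add: cong_def)
  finally show ?thesis by (simp add: eps4_def)
qed

lemma eps8_cong:
  assumes "loc_cong 2 8 u (of_int r)"
  shows "eps8 u = (if r mod 8 = 1 \<or> r mod 8 = 7 then 0 else 1)"
proof -
  have t: "prime (2::nat)" by simp
  have "loc_cong 2 8 u (of_int s) \<longleftrightarrow> r mod 8 = s mod 8" for s
  proof -
    have "loc_cong 2 8 u (of_int s) \<longleftrightarrow> loc_cong 2 8 (of_int r) (of_int s)"
      using loc_cong_trans[OF t] loc_cong_sym[OF t] assms by blast
    thus ?thesis using loc_cong_of_int_iff[OF t, of 3 r s] by (simp add: cong_def)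
  qed
  \<comment> \<open>The residue of -1 modulo 8 is 7.\<close>
  from this[of 1] this[of "- 1"] show ?thesis by (simp add: eps8_def)
qed

lemma eps_of_int:
  "eps4 (of_int r) = (if r mod 4 = 1 then 0 else 1)"
  "eps8 (of_int r) = (if r mod 8 = 1 \<or> r mod 8 = 7 then 0 else 1)"
  by (intro eps4_cong eps8_cong loc_cong_refl two_is_prime_nat)+

text \<open>Additivity in the field with two elements, stated as evenness because the values are
  natural numbers.\<close>

lemma eps_mult:
  assumes u: "u \<in> loc_units 2" and w: "w \<in> loc_units 2"
  shows "even (eps4 (u * w) + eps4 u + eps4 w)" "even (eps8 (u * w) + eps8 u + eps8 w)"
proof -
  have t: "prime (2::nat)" by simp
  have e: "int 2 ^ 3 = 8" by simp
  obtain r where r: "loc_cong 2 8 u (of_int r)"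
    using loc_int_cong_of_int[OF t loc_units_subset[OF t u], of 3] unfolding e .
  obtain s where s: "loc_cong 2 8 w (of_int s)"
    using loc_int_cong_of_int[OF t loc_units_subset[OF t w], of 3] unfolding e .
  have rs: "loc_cong 2 8 (u * w) (of_int (r * s))"
    using loc_cong_mult[OF t r s loc_units_subset[OF t u] of_int_in_loc_int[OF t]] by simp
  have "odd r" "odd s"
    using loc_unit_cong_not_dvd[OF t u, of 3 r] loc_unit_cong_not_dvd[OF t w, of 3 s] r s by auto
  hence r8: "r mod 8 \<in> {1, 3, 5, 7}" "s mod 8 \<in> {1, 3, 5, 7}"
    and r4: "r mod 4 \<in> {1, 3}" "s mod 4 \<in> {1, 3}"
    by (simp_all, presburger+)
  \<comment> \<open>These are \<open>eps4\<close> and \<open>eps8\<close> on residues, so only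
    products of odd residues modulo 4 and 8 remain to be checked.\<close>
  define f4 f8 :: "int \<Rightarrow> nat" where "f4 x = (if x = 1 then 0 else 1)"
    and "f8 x = (if x = 1 \<or> x = 7 then 0 else 1)" for x
  have "even (f4 (x * y mod 4) + f4 x + f4 y)" if "x \<in> {1, 3}" "y \<in> {1, 3}" for x y
    using that by (auto simp: f4_def)
  from this[OF r4] show "even (eps4 (u * w) + eps4 u + eps4 w)"
    unfolding eps4_cong[OF r] eps4_cong[OF s] eps4_cong[OF rs] f4_def mod_mult_eq .
  have "even (f8 (x * y mod 8) + f8 x + f8 y)" if "x \<in> {1, 3, 5, 7}" "y \<in> {1, 3, 5, 7}" for x y
    using that unfolding f8_def by (elim insertE emptyE; hypsubst) simp_all
  from this[OF r8] show "even (eps8 (u * w) + eps8 u + eps8 w)"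
    unfolding eps8_cong[OF r] eps8_cong[OF s] eps8_cong[OF rs] f8_def mod_mult_eq .
qed

section \<open>Bimultiplicativity and symmetry of the symbol\<close>

lemma Legendre_one:
  assumes "1 < p"
  shows "Legendre 1 p = 1"
proof -
  have "\<not> [1 = 0] (mod p)" using assms by (simp add: cong_def)
  moreover have "QuadRes p 1" unfolding QuadRes_def by (rule exI[of _ 1]) simp
  ultimately show ?thesis by (simp add: Legendre_def)
qed

lemma lambda_one:
  assumes "prime p"
  shows "lambda p 1 = 1"
proof -
  have "lambda p 1 = Legendre 1 (int p)"
    using lambda_eq_Legendre[OF assms one_in_loc_units[OF assms], of 1] loc_cong_refl[OF assms]
    by simp
  thus ?thesis using Legendre_one prime_gt_1_nat[OF assms] by simp
qed

lemma lambda_mult: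
  assumes p: "prime p" "2 < p" and u: "u \<in> loc_units p" and w: "w \<in> loc_units p"
  shows "lambda p (u * w) = lambda p u * lambda p w"
proof -
  have e: "int p ^ 1 = int p" by simp
  obtain r where r: "loc_cong p (int p) u (of_int r)"
    using loc_int_cong_of_int[OF p(1) loc_units_subset[OF p(1) u], of 1] unfolding e .
  obtain s where s: "loc_cong p (int p) w (of_int s)"
    using loc_int_cong_of_int[OF p(1) loc_units_subset[OF p(1) w], of 1] unfolding e .
  have rs: "loc_cong p (int p) (u * w) (of_int (r * s))"
    using loc_cong_mult[OF p(1) r s loc_units_subset[OF p(1) u] of_int_in_loc_int[OF p(1)]] by simp
  show ?thesis
    using lambda_eq_Legendre[OF p(1) u r] lambda_eq_Legendre[OF p(1) w s]
      lambda_eq_Legendre[OF p(1) loc_units_mult[OF p(1) u w] rs] Legendre_mult[OF p]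
    by simp
qed

lemma lambda_squared: "lambda p u * lambda p u = 1"
  by (simp add: lambda_def)

text \<open>The two signs multiply to \<open>lambda p 1 = 1\<close>, hence they agree.\<close>

lemma lambda_inverse:
  assumes p: "prime p" "2 < p" and u: "u \<in> loc_units p"
  shows "lambda p (inverse u) = lambda p u"
proof -
  have "lambda p u * lambda p (inverse u) = lambda p (u * inverse u)"
    by (rule lambda_mult[OF p u loc_units_inverse[OF p(1) u], symmetric])
  also have "\<dots> = 1" using loc_units_nonzero[OF p(1) u] lambda_one[OF p(1)] by simp
  finally show ?thesis by (auto simp: lambda_def split: if_splits)
qed

lemma eps8_inverse:
  assumes u: "u \<in> loc_units 2"
  shows "eps8 (inverse u) = eps8 u"
proof -
  have t: "prime (2::nat)" by simp
  have "u * inverse u = of_int 1" using loc_units_nonzero[OF t u] by simp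
  hence "eps8 (u * inverse u) = 0" using eps_of_int(2)[of 1] by simp
  thus ?thesis using eps_mult(2)[OF u loc_units_inverse[OF t u]]
    by (auto simp: eps8_def split: if_splits)
qed

lemma placesE:
  assumes "v \<in> places"
  obtains "v = Infinite_Place" | "v = Finite_Place 2"
    | p where "prime p" "2 < p" "v = Finite_Place p"
proof (cases v)
  case (Finite_Place p)
  with assms have p: "prime p" by (auto simp: places_def)
  show ?thesis
  proof (cases "p = 2")
    case False
    with prime_ge_2_nat[OF p] have "2 < p" by linarith
    thus ?thesis using that(3) p Finite_Place by blast
  qed (use that(2) Finite_Place in simp)
qed (use that(1) in simp)

lemma hilbert_symbol_squared: "hilbert_symbol a b v * hilbert_symbol a b v = 1"
  by (cases v) (auto simp: lambda_squared simp flip: power_add mult_2)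

text \<open>Exchanging the arguments inverts the tame symbol, and neither \<open>lambda\<close> nor
  \<open>eps8\<close> distinguishes a unit from its inverse.\<close>

lemma hilbert_symbol_commute:
  assumes "v \<in> places" "a \<noteq> 0" "b \<noteq> 0"
  shows "hilbert_symbol a b v = hilbert_symbol b a v"
  using assms(1)
proof (cases rule: placesE)
  case 2
  have t: "prime (2::nat)" by simp
  show ?thesis
    using eps8_inverse[OF tame_in_loc_units[OF t assms(2,3)]] tame_swap[OF t, of b a]
    by (simp add: 2 mult.commute)
next
  case (3 p)
  thus ?thesis
    using lambda_inverse[OF _ _ tame_in_loc_units[OF _ assms(2,3)]] tame_swap[of p b a] by simp
qed auto

text \<open>At a prime the tame symbol is multiplicative in its first argument, and
  \<open>lambda\<close> and \<open>eps8\<close> carry this to signs. At 2 the additivity of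
  \<open>eps4\<close> handles the remaining term.\<close>

lemma hilbert_symbol_mult_left:
  assumes "v \<in> places" "a \<noteq> 0" "b \<noteq> 0" "c \<noteq> 0"
  shows "hilbert_symbol (a * b) c v = hilbert_symbol a c v * hilbert_symbol b c v"
  using assms(1)
proof (cases rule: placesE)
  case 1
  thus ?thesis using assms by (auto simp: zero_less_mult_iff)
next
  case 2
  have t: "prime (2::nat)" by simp
  note U = unit_part_in_loc_units[OF t]
  \<comment> \<open>Converts additivity modulo 2, given as evenness of a three-term sum, into
    multiplicativity of signs.\<close>
  have par: "even (i + j + k) \<Longrightarrow> (- 1 :: int) ^ i = (- 1) ^ j * (- 1) ^ k" for i j k :: nat
    by (auto simp: minus_one_power_iff)
  have "even (eps4 (unit_part 2 (a * b)) + eps4 (unit_part 2 a) + eps4 (unit_part 2 b))"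
    using eps_mult(1)[OF U U] val_unit_part_mult(2)[OF t] assms by simp
  \<comment> \<open>Multiplying by the value at \<open>c\<close> passes from additivity of
    \<open>eps4\<close> to the product occurring in the exponent.\<close>
  hence "even ((eps4 (unit_part 2 (a * b)) + eps4 (unit_part 2 a) + eps4 (unit_part 2 b))
      * eps4 (unit_part 2 c))" by simp
  hence "(- 1 :: int) ^ (eps4 (unit_part 2 (a * b)) * eps4 (unit_part 2 c))
      = (- 1) ^ (eps4 (unit_part 2 a) * eps4 (unit_part 2 c))
        * (- 1) ^ (eps4 (unit_part 2 b) * eps4 (unit_part 2 c))"
    by (intro par) (simp only: distrib_right)
  moreover have "(- 1 :: int) ^ eps8 (tame 2 (a * b) c)
      = (- 1) ^ eps8 (tame 2 a c) * (- 1) ^ eps8 (tame 2 b c)"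
    unfolding tame_mult[OF t assms(2-4)]
    by (intro par eps_mult tame_in_loc_units[OF t] assms)
  ultimately show ?thesis by (simp add: 2 power_add)
next
  case (3 p)
  thus ?thesis
    using tame_mult[OF _ assms(2-4)] lambda_mult tame_in_loc_units assms by simp
qed

section \<open>The product formula as a predicate\<close>

text \<open>A product over an infinite set is 1 by convention, so the product runs over the places
  with nontrivial symbol and their finiteness is a separate conjunct.\<close>

definition product_formula :: "rat \<Rightarrow> rat \<Rightarrow> bool" where
  "product_formula a b \<longleftrightarrow> finite {v \<in> places. hilbert_symbol a b v \<noteq> 1}
    \<and> (\<Prod>v \<in> {v \<in> places. hilbert_symbol a b v \<noteq> 1}. hilbert_symbol a b v) = 1"

text \<open>Enlarging the support only adds factors 1. This allows symbols with different supports
  to be compared on a common finite set.\<close>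

lemma product_formula_iff:
  assumes "finite S" "S \<subseteq> places" "\<And>v. v \<in> places - S \<Longrightarrow> hilbert_symbol a b v = 1"
  shows "product_formula a b \<longleftrightarrow> (\<Prod>v\<in>S. hilbert_symbol a b v) = 1"
proof -
  let ?T = "{v \<in> places. hilbert_symbol a b v \<noteq> 1}"
  have sub: "?T \<subseteq> S" using assms by blast
  moreover have "prod (hilbert_symbol a b) ?T = prod (hilbert_symbol a b) S"
    using assms sub by (intro prod.mono_neutral_left) auto
  ultimately show ?thesis unfolding product_formula_def
    using finite_subset[OF sub assms(1)] by simp
qed

lemma product_formula_commute:
  assumes "a \<noteq> 0" "b \<noteq> 0" "product_formula a b"
  shows "product_formula b a"
proof -
  let ?T = "{v \<in> places. hilbert_symbol a b v \<noteq> 1}"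
  have c: "hilbert_symbol b a v = hilbert_symbol a b v" if "v \<in> places" for v
    using hilbert_symbol_commute that assms by simp
  have "product_formula b a \<longleftrightarrow> prod (hilbert_symbol b a) ?T = 1"
    using assms(3) by (intro product_formula_iff) (auto simp: c product_formula_def)
  also have "prod (hilbert_symbol b a) ?T = prod (hilbert_symbol a b) ?T"
    by (intro prod.cong) (auto simp: c)
  finally show ?thesis using assms(3) by (simp add: product_formula_def)
qed

lemma product_formula_mult:
  assumes nz: "a \<noteq> 0" "b \<noteq> 0" "c \<noteq> 0"
    and a: "product_formula a c" and b: "product_formula b c"
  shows "product_formula (a * b) c"
proof -
  \<comment> \<open>The union of both supports contains the support of the product symbol.\<close>
  define S where "S = {v \<in> places. hilbert_symbol a c v \<noteq> 1} \<union> {v \<in> places. hilbert_symbol b c v \<noteq> 1}"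
  have S: "finite S" "S \<subseteq> places"
    using a b unfolding S_def product_formula_def by auto
  have m: "hilbert_symbol (a * b) c v = hilbert_symbol a c v * hilbert_symbol b c v"
    if "v \<in> places" for v
    using hilbert_symbol_mult_left[OF that nz] .
  have "prod (hilbert_symbol (a * b) c) S = (\<Prod>v\<in>S. hilbert_symbol a c v * hilbert_symbol b c v)"
    using S by (intro prod.cong) (auto simp: m)
  also have "\<dots> = prod (hilbert_symbol a c) S * prod (hilbert_symbol b c) S"
    by (rule prod.distrib)
  also have "prod (hilbert_symbol a c) S = 1"
    using a by (subst (asm) product_formula_iff[OF S]) (auto simp: S_def)
  also have "prod (hilbert_symbol b c) S = 1"
    using b by (subst (asm) product_formula_iff[OF S]) (auto simp: S_def)
  finally show ?thesis
    by (subst product_formula_iff[OF S]) (auto simp: m, auto simp: S_def)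
qed

text \<open>The sign of \<open>b\<close> enters twice and cancels; this serves to clear
  denominators.\<close>

lemma product_formula_mult_square:
  assumes nz: "a \<noteq> 0" "b \<noteq> 0" "c \<noteq> 0" and a: "product_formula (a * b * b) c"
  shows "product_formula a c"
proof -
  have eq: "hilbert_symbol a c v = hilbert_symbol (a * b * b) c v" if "v \<in> places" for v
    using hilbert_symbol_mult_left[OF that] hilbert_symbol_squared[of b c v] nz by simp
  have T: "{v \<in> places. hilbert_symbol a c v \<noteq> 1} = {v \<in> places. hilbert_symbol (a * b * b) c v \<noteq> 1}"
    by (auto simp: eq)
  have "(\<Prod>v | v \<in> places \<and> hilbert_symbol a c v \<noteq> 1. hilbert_symbol a c v)
      = (\<Prod>v | v \<in> places \<and> hilbert_symbol (a * b * b) c v \<noteq> 1. hilbert_symbol (a * b * b) c v)"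
    by (intro prod.cong T eq) auto
  thus ?thesis using a unfolding product_formula_def T by simp
qed

lemma product_formula_of_int:
  assumes n: "n \<noteq> 0" and c: "c \<noteq> 0"
    and neg: "product_formula (- 1) c"
    and pr: "\<And>p. prime p \<Longrightarrow> product_formula (of_nat p) c"
  shows "product_formula (of_int n) c"
  using n
proof (induction n rule: prime_divisors_induct)
  case (unit n)
  \<comment> \<open>The unit 1 is reached as the square of the generator -1.\<close>
  have "product_formula ((- 1) * (- 1)) c"
    by (rule product_formula_mult[OF _ _ c neg neg]) auto
  moreover have "n = 1 \<or> n = - 1" using unit by auto
  ultimately show ?case using neg by auto
next
  case (factor p n)
  have p: "p \<ge> 0" "prime (nat p)" using factor.hyps prime_int_nat_transfer by blast+
  have "product_formula (of_int p) c"
    using pr[OF p(2)] unfolding of_nat_nat[OF p(1)] .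
  moreover have "n \<noteq> 0" "p \<noteq> 0" using factor.prems by auto
  ultimately show ?case
    unfolding of_int_mult using factor.IH c by (intro product_formula_mult) simp_all
qed simp

lemma product_formula_of_generators:
  assumes a: "a \<noteq> 0" and c: "c \<noteq> 0"
    and neg: "product_formula (- 1) c"
    and pr: "\<And>p. prime p \<Longrightarrow> product_formula (of_nat p) c"
  shows "product_formula a c"
proof -
  obtain m n :: int where mn: "a = of_int m / of_int n" "n > 0"
    by (metis Fract_of_int_quotient quotient_of_denom_pos quotient_of_div surj_pair)
  have nz: "m \<noteq> 0" "n \<noteq> 0" using mn a by auto
  have "product_formula (of_int (m * n)) c"
    by (rule product_formula_of_int[OF _ c neg pr]) (use nz in simp_all)
  also have "of_int (m * n) = a * of_int n * of_int n"
    using nz by (simp add: mn(1))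
  finally show ?thesis
    using product_formula_mult_square[OF a _ c, of "of_int n"] nz(2)
    by (simp only: of_int_eq_0_iff not_False_eq_True simp_thms)
qed

section \<open>The product formula for generators\<close>

text \<open>Both valuations vanish, so the tame symbol is 1. This is the source of the finiteness
  statement.\<close>

lemma hilbert_symbol_units:
  assumes "prime p" "2 < p" "x \<in> loc_units p" "y \<in> loc_units p"
  shows "hilbert_symbol x y (Finite_Place p) = 1"
  using assms lambda_one by (simp add: tame_def val_unit_part_of_unit)

lemma hilbert_symbol_unit_prime:
  assumes "prime p" "2 < p" "\<not> int p dvd r"
  shows "hilbert_symbol (of_int r) (of_nat p) (Finite_Place p) = Legendre r (int p)"
  using assms lambda_eq_Legendre[OF _ of_int_in_loc_units loc_cong_refl, of p r]
  by (simp add: tame_def val_unit_part_of_unit[OF _ of_int_in_loc_units] val_unit_part_self)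

text \<open>Both unit parts are 1 and both valuations are 1, so the tame symbol is just its sign
  factor -1.\<close>

lemma hilbert_symbol_prime_self:
  assumes "prime p" "2 < p"
  shows "hilbert_symbol (of_nat p) (of_nat p) (Finite_Place p) = Legendre (- 1) (int p)"
  using assms lambda_eq_Legendre[OF _ minus_one_in_loc_units, of p "- 1"]
    loc_cong_refl[of p "int p" "- 1"]
  by (simp add: tame_def val_unit_part_self)

text \<open>The tame symbol of two units is 1, so only the \<open>eps4\<close> term
  survives.\<close>

lemma hilbert_symbol_2_odd:
  assumes "odd r" "odd s"
  shows "hilbert_symbol (of_int r) (of_int s) (Finite_Place 2)
    = (if r mod 4 = 1 \<or> s mod 4 = 1 then 1 else - 1)"
proof -
  have t: "prime (2::nat)" by simp
  show ?thesis
    using assms eps_of_int(2)[of 1]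
    by (simp add: tame_def val_unit_part_of_unit[OF t of_int_in_loc_units[OF t]] eps_of_int)
qed

text \<open>The unit part of 2 is 1, which kills the \<open>eps4\<close> term, and the tame symbol
  is \<open>r\<close>.\<close>

lemma hilbert_symbol_2_odd_two:
  assumes "odd r"
  shows "hilbert_symbol (of_int r) 2 (Finite_Place 2) = (if r mod 8 = 1 \<or> r mod 8 = 7 then 1 else - 1)"
proof -
  have t: "prime (2::nat)" by simp
  show ?thesis
    using assms eps_of_int(1)[of 1] val_unit_part_self[OF t]
    by (simp add: tame_def val_unit_part_of_unit[OF t of_int_in_loc_units[OF t]] eps_of_int)
qed

text \<open>The tame symbol is -1, which is 7 modulo 8, so \<open>eps8\<close> vanishes.\<close>

lemma hilbert_symbol_2_two_two: "hilbert_symbol 2 2 (Finite_Place 2) = 1"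
proof -
  have t: "prime (2::nat)" by simp
  show ?thesis
    using eps_of_int(1)[of 1] eps_of_int(2)[of "- 1"] val_unit_part_self[OF t]
    by (simp add: tame_def)
qed

text \<open>Outside infinity, 2 and \<open>F\<close> both arguments are units, so the formula
  becomes an explicit finite product.\<close>

lemma product_formula_iff_odd_primes:
  assumes F: "finite F" "\<And>p. p \<in> F \<Longrightarrow> prime p \<and> 2 < p"
    and units: "\<And>p. prime p \<Longrightarrow> 2 < p \<Longrightarrow> p \<notin> F \<Longrightarrow> x \<in> loc_units p \<and> y \<in> loc_units p"
  shows "product_formula x y \<longleftrightarrow>
    hilbert_symbol x y Infinite_Place * (hilbert_symbol x y (Finite_Place 2)
      * (\<Prod>p\<in>F. hilbert_symbol x y (Finite_Place p))) = 1"
proof -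
  let ?S = "insert Infinite_Place (Finite_Place ` insert 2 F)"
  have "2 \<notin> F" using F(2) by blast
  have "product_formula x y \<longleftrightarrow> prod (hilbert_symbol x y) ?S = 1"
  proof (rule product_formula_iff)
    show "finite ?S" using F by simp
    show "?S \<subseteq> places" using F(2) by (auto simp: places_def)
  next
    fix v assume "v \<in> places - ?S"
    hence v: "v \<in> places" "v \<notin> ?S" by auto
    from v(1) show "hilbert_symbol x y v = 1"
    proof (cases rule: placesE)
      case (3 p)
      thus ?thesis using v(2) units hilbert_symbol_units by blast
    qed (use v(2) in auto)
  qed
  also have "prod (hilbert_symbol x y) ?S
      = hilbert_symbol x y Infinite_Place * prod (hilbert_symbol x y) (Finite_Place ` insert 2 F)"
    using F by (intro prod.insert) auto
  also have "prod (hilbert_symbol x y) (Finite_Place ` insert 2 F)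
      = (\<Prod>p\<in>insert 2 F. hilbert_symbol x y (Finite_Place p))"
    by (subst prod.reindex) (auto simp: inj_on_def)
  also have "\<dots> = hilbert_symbol x y (Finite_Place 2) * (\<Prod>p\<in>F. hilbert_symbol x y (Finite_Place p))"
    using F \<open>2 \<notin> F\<close> by (intro prod.insert) auto
  finally show ?thesis .
qed

lemma prime_not_dvd_prime:
  fixes p q :: nat
  assumes "prime p" "prime q" "p \<noteq> q"
  shows "\<not> int p dvd int q"
  using primes_dvd_imp_eq[OF assms(1,2)] assms(3) by auto

lemma of_nat_prime_in_loc_units:
  assumes "prime p" "prime q" "p \<noteq> q"
  shows "of_nat q \<in> loc_units p"
  using of_int_in_loc_units[OF assms(1) prime_not_dvd_prime[OF assms]] by simp

lemma two_in_loc_units: "prime p \<Longrightarrow> 2 < p \<Longrightarrow> 2 \<in> loc_units p"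
  using of_nat_prime_in_loc_units[of p 2] by simp

text \<open>Matches the exponents of the reciprocity laws with the condition modulo 4 in
  \<open>eps4\<close>.\<close>

lemma half_power_sign:
  fixes p :: nat
  assumes "odd p"
  shows "(- 1 :: int) ^ ((p - 1) div 2) = (if int p mod 4 = 1 then 1 else - 1)"
proof -
  obtain k where k: "p = 2 * k + 1" using assms oddE by blast
  show ?thesis
  proof (cases "even k")
    case True
    then obtain j where "k = 2 * j" by blast
    thus ?thesis by (simp add: k)
  next
    case False
    then obtain j where "k = 2 * j + 1" using oddE by blast
    thus ?thesis by (simp add: k)
  qed
qed

section \<open>Pairs formed from -1 and 2\<close>

lemma product_formula_neg_neg: "product_formula (- 1) (- 1)"
proof -
  \<comment> \<open>This sign cancels the one at infinity.\<close>
  have "hilbert_symbol (- 1) (- 1) (Finite_Place 2) = - 1"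
    using hilbert_symbol_2_odd[of "- 1" "- 1"] by simp
  thus ?thesis
    by (subst product_formula_iff_odd_primes[of "{}"]) (auto simp: minus_one_in_loc_units)
qed

lemma product_formula_neg_two: "product_formula (- 1) 2"
proof -
  have "hilbert_symbol (- 1) 2 (Finite_Place 2) = 1"
    using hilbert_symbol_2_odd_two[of "- 1"] by simp
  thus ?thesis
    by (subst product_formula_iff_odd_primes[of "{}"])
      (auto simp: minus_one_in_loc_units two_in_loc_units)
qed

lemma product_formula_two_two: "product_formula 2 2"
  using hilbert_symbol_2_two_two
  by (subst product_formula_iff_odd_primes[of "{}"]) (auto simp: two_in_loc_units)

section \<open>Pairs involving an odd prime\<close>

context
  fixes p :: nat
  assumes p: "prime p" "2 < p"
begin

lemma odd_prime: "odd p"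
  using p prime_odd_nat by blast

text \<open>First supplementary law: the places 2 and \<open>p\<close> give the same sign, depending
  on \<open>p\<close> modulo 4.\<close>

lemma product_formula_neg_odd: "product_formula (- 1) (of_nat p)"
proof -
  have "hilbert_symbol (- 1) (of_nat p) (Finite_Place 2) = (if int p mod 4 = 1 then 1 else - 1)"
    using hilbert_symbol_2_odd[of "- 1" "int p"] odd_prime by simp
  moreover have "hilbert_symbol (- 1) (of_nat p) (Finite_Place p) = (if int p mod 4 = 1 then 1 else - 1)"
    using hilbert_symbol_unit_prime[OF p, of "- 1"] p Legendre_minus_one[OF p]
      half_power_sign[OF odd_prime] by simp
  ultimately show ?thesis using p
    by (subst product_formula_iff_odd_primes[of "{p}"])
      (auto simp: minus_one_in_loc_units of_nat_prime_in_loc_units simp del: hilbert_symbol.simps(1))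
qed

text \<open>The symbol at \<open>p\<close> is again the Legendre symbol of -1, so the signs are
  those of the pair of -1 and \<open>p\<close>.\<close>

lemma product_formula_odd_self: "product_formula (of_nat p) (of_nat p)"
proof -
  have "hilbert_symbol (of_nat p) (of_nat p) (Finite_Place 2) = (if int p mod 4 = 1 then 1 else - 1)"
    using hilbert_symbol_2_odd[of "int p" "int p"] odd_prime by simp
  moreover have "hilbert_symbol (of_nat p) (of_nat p) (Finite_Place p) = (if int p mod 4 = 1 then 1 else - 1)"
    using hilbert_symbol_prime_self[OF p] Legendre_minus_one[OF p] half_power_sign[OF odd_prime]
    by simp
  ultimately show ?thesis using p
    by (subst product_formula_iff_odd_primes[of "{p}"])
      (auto simp: of_nat_prime_in_loc_units simp del: hilbert_symbol.simps(1))
qed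

text \<open>Second supplementary law: the condition modulo 8 in \<open>Legendre_two\<close> is the
  one defining \<open>eps8\<close>, so the signs at 2 and \<open>p\<close> agree.\<close>

lemma product_formula_two_odd: "product_formula 2 (of_nat p)"
proof -
  have "Finite_Place 2 \<in> places" by (simp add: places_def)
  hence "hilbert_symbol 2 (of_nat p) (Finite_Place 2) = hilbert_symbol (of_nat p) 2 (Finite_Place 2)"
    using p by (intro hilbert_symbol_commute) auto
  also have "\<dots> = Legendre 2 (int p)"
    using hilbert_symbol_2_odd_two[of "int p"] odd_prime Legendre_two[OF p] by simp
  finally have "hilbert_symbol 2 (of_nat p) (Finite_Place 2) = Legendre 2 (int p)" .
  moreover have "\<not> int p dvd 2" using p by (auto dest: zdvd_imp_le)
  hence "hilbert_symbol 2 (of_nat p) (Finite_Place p) = Legendre 2 (int p)"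
    using hilbert_symbol_unit_prime[OF p, of 2] by simp
  moreover have "Legendre 2 (int p) * Legendre 2 (int p) = 1"
    by (simp add: Legendre_two[OF p])
  ultimately show ?thesis using p
    by (subst product_formula_iff_odd_primes[of "{p}"])
      (auto simp: of_nat_prime_in_loc_units two_in_loc_units simp del: hilbert_symbol.simps(1))
qed

lemma product_formula_odd_odd:
  assumes q: "prime q" "2 < q" and neq: "p \<noteq> q"
  shows "product_formula (of_nat p) (of_nat q)"
proof -
  let ?s = "if int p mod 4 = 1 \<or> int q mod 4 = 1 then 1 else - 1 :: int"
  have "odd q" using q prime_odd_nat by blast
  have two: "hilbert_symbol (of_nat p) (of_nat q) (Finite_Place 2) = ?s"
    using hilbert_symbol_2_odd[of "int p" "int q"] odd_prime \<open>odd q\<close> by simp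
  have "Finite_Place p \<in> places" using p by (simp add: places_def)
  hence "hilbert_symbol (of_nat p) (of_nat q) (Finite_Place p)
      = hilbert_symbol (of_nat q) (of_nat p) (Finite_Place p)"
    using p q by (intro hilbert_symbol_commute) auto
  also have "\<dots> = Legendre (int q) (int p)"
    using hilbert_symbol_unit_prime[OF p prime_not_dvd_prime[OF p(1) q(1) neq]] by simp
  finally have at_p: "hilbert_symbol (of_nat p) (of_nat q) (Finite_Place p) = Legendre (int q) (int p)" .
  have at_q: "hilbert_symbol (of_nat p) (of_nat q) (Finite_Place q) = Legendre (int p) (int q)"
    using hilbert_symbol_unit_prime[OF q prime_not_dvd_prime[OF q(1) p(1) neq[symmetric]]] by simp
  \<comment> \<open>Quadratic reciprocity, with the exponent split into a nested power so that
    \<open>half_power_sign\<close> applies to \<open>p\<close> and then to \<open>q\<close>.\<close>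
  have "Legendre (int p) (int q) * Legendre (int q) (int p) = ((- 1) ^ ((p - 1) div 2)) ^ ((q - 1) div 2)"
    unfolding power_mult[symmetric] by (rule Quadratic_Reciprocity[OF p q neq])
  also have "\<dots> = ?s"
    unfolding half_power_sign[OF odd_prime] using half_power_sign[OF \<open>odd q\<close>] by simp
  finally have "Legendre (int q) (int p) * Legendre (int p) (int q) = ?s" by (simp only: mult.commute)
  moreover have "(\<Prod>l\<in>{p, q}. hilbert_symbol (of_nat p) (of_nat q) (Finite_Place l))
      = Legendre (int q) (int p) * Legendre (int p) (int q)"
    using neq at_p at_q by (simp del: hilbert_symbol.simps(1))
  \<comment> \<open>Infinity contributes 1, and the places \<open>p\<close> and \<open>q\<close>
    together reproduce the sign \<open>?s\<close> at 2, whose square is 1.\<close>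
  ultimately have "hilbert_symbol (of_nat p) (of_nat q) Infinite_Place
      * (hilbert_symbol (of_nat p) (of_nat q) (Finite_Place 2)
      * (\<Prod>l\<in>{p, q}. hilbert_symbol (of_nat p) (of_nat q) (Finite_Place l))) = 1"
    using p by (simp add: two del: hilbert_symbol.simps(1))
  thus ?thesis using p q
    by (subst product_formula_iff_odd_primes[of "{p, q}"]) (auto simp: of_nat_prime_in_loc_units
        simp del: hilbert_symbol.simps)
qed

end

section \<open>From generators to all pairs\<close>

lemma product_formula_neg_prime:
  assumes "prime p"
  shows "product_formula (- 1) (of_nat p)"
proof (cases "p = 2")
  case False
  thus ?thesis using assms prime_ge_2_nat[OF assms] product_formula_neg_odd by simp
qed (simp add: product_formula_neg_two)

lemma product_formula_primes:
  assumes "prime p" "prime q"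
  shows "product_formula (of_nat p) (of_nat q)"
proof -
  have p: "p = 2 \<or> 2 < p" and q: "q = 2 \<or> 2 < q"
    using assms[THEN prime_ge_2_nat] by linarith+
  have two: "product_formula (of_nat 2) (of_nat r)" if "prime r" "r = 2 \<or> 2 < r" for r
    using that product_formula_two_two product_formula_two_odd by auto
  show ?thesis
  proof (cases "p = 2 \<or> q = 2")
    case True
    \<comment> \<open>When \<open>q\<close> is 2, the claim comes from \<open>two\<close> by
      symmetry.\<close>
    thus ?thesis
      using two assms p q product_formula_commute[of "of_nat 2" "of_nat p"] prime_gt_0_nat by auto
  next
    case False
    thus ?thesis
      using p q assms product_formula_odd_self product_formula_odd_odd by (cases "p = q") auto
  qed
qed

theorem mainTheorem1:
  fixes a b :: rat
  assumes "a \<noteq> 0" and "b \<noteq> 0"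
  shows "finite {v \<in> places. hilbert_symbol a b v \<noteq> 1}
    \<and> (\<Prod>v \<in> {v \<in> places. hilbert_symbol a b v \<noteq> 1}. hilbert_symbol a b v) = 1"
proof -
  have nz: "(of_nat p :: rat) \<noteq> 0" if "prime p" for p using that by auto
  \<comment> \<open>Generators are used in one argument at a time: first \<open>b\<close> is
    decomposed against -1 and against each prime, then symmetry allows \<open>a\<close> to be
    decomposed against \<open>b\<close>.\<close>
  have neg: "product_formula b (- 1)"
    by (rule product_formula_of_generators[OF assms(2)])
      (auto intro: product_formula_neg_neg product_formula_commute[OF _ nz product_formula_neg_prime])
  have pr: "product_formula b (of_nat p)" if "prime p" for p
    by (rule product_formula_of_generators[OF assms(2) nz[OF that]])
      (auto intro: product_formula_neg_prime product_formula_primes that)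
  have "product_formula a b"
    by (rule product_formula_of_generators[OF assms product_formula_commute[OF assms(2) _ neg]
          product_formula_commute[OF assms(2) nz pr]]) auto
  thus ?thesis unfolding product_formula_def .
qed

end
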